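(* Let $p,n\ge 2$ be integers with $p\le n$. Let $G=K_{2^{n-p},2^{n-p},\ldots,2^{n-p}}$ be the complete $2^p$-partite graph on $2^n$ vertices, labeled by $1,\ldots,2^n$ so that its parts are the residue classes modulo $2^p$. Let $H=T_n^1$ be the $1$-rooted complete binary tree on $2^n$ vertices, labeled by $1,\ldots,2^n$ according to the inorder traversal. Let $f:G\to H$ be the embedding that maps the vertex of $G$ labeled $x$ to the vertex of $H$ labeled $x$, for every $x$, and assigns to each edge $ab$ of $G$ a shortest path $P_f(ab)$ in $H$ between $f(a)$ and $f(b)$. Then $f$ has minimum wirelength among all embeddings of $G$ into $H$, and $$WL(G,H)=\sum_{j=1}^{n}\sum_{i=1}^{2^{n-j}} c_j,$$ where $$c_j=\begin{cases}(2^j-1)\bigl(2^{n-p}(2^p-1)-(2^j-2)\bigr), & j\le p,\\ (2^p-1)\bigl(2^{n-p}(2^j-1)-2^{j-p}(2^j-2)\bigr), & j>p.\end{cases}$$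
   Context: All graphs are finite and simple. An embedding $f$ of a graph $G$ into a graph $H$ is an injective map $f:V(G)\to V(H)$ together with, for each edge $e=xy$ of $G$, a path $P_f(e)$ in $H$ between $f(x)$ and $f(y)$ (not necessarily shortest). Its wirelength $WL_f(G,H)$ is the sum over $e\in E(G)$ of the length of $P_f(e)$; equivalently, $\sum_{e\in E(H)}EC_f(e)$, where $EC_f(e)$ is the number of edges $e'$ of $G$ such that $e$ lies on $P_f(e')$. The wirelength of $G$ into $H$ is $WL(G,H)=\min_f WL_f(G,H)$, over all embeddings $f$ of $G$ into $H$. The complete $2^p$-partite graph $K_{2^{n-p},\ldots,2^{n-p}}$ has its vertex set partitioned into $2^p$ independent sets (parts), each of size $2^{n-p}$, with all possible edges between vertices in different parts. The complete binary tree $T_n$ is the rooted binary tree with $n$ levels, level $i$ ($1\le i\le n$) containing $2^{i-1}$ vertices, in which each internal vertex has exactly two children (left and right) and all leaves are on level $n$; it has $2^n-1$ vertices. The $1$-rooted complete binary tree $T_n^1$ is obtained from $T_n$ by attaching a pendant edge to its root; the new vertex is the root of $T_n^1$ (level $0$), and $T_n^1$ has $2^n$ vertices. Inorder labeling of $T_n^1$: recursively, for each internal vertex of $T_n$, list the left subtree, then the vertex, then the right subtree; this labels the vertices of $T_n$ by $1,\ldots,2^n-1$, and the root of $T_n^1$ receives label $2^n$. *)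

theory Defs
  imports Complex_Main "HOL-Library.Tree" "HOL-Library.Disjoint_Sets"
begin

section \<open>Finite simple graphs and paths\<close>

record 'a graph =
  verts :: "'a set"
  edges :: "'a set set"

definition simple_graph :: "'a graph \<Rightarrow> bool" where
  "simple_graph G \<longleftrightarrow> finite (verts G) \<and> (\<forall>e\<in>edges G. e \<subseteq> verts G \<and> card e = 2)"

definition is_path :: "'a graph \<Rightarrow> 'a list \<Rightarrow> bool" where
  "is_path G xs \<longleftrightarrow>
     xs \<noteq> [] \<and> distinct xs \<and> set xs \<subseteq> verts G \<and> successively (\<lambda>x y. {x, y} \<in> edges G) xs"

text \<open>Paths are undirected: the list may run from \<open>u\<close> to \<open>v\<close> or from \<open>v\<close> to \<open>u\<close>.\<close>

definition path_between :: "'a graph \<Rightarrow> 'a \<Rightarrow> 'a \<Rightarrow> 'a list \<Rightarrow> bool" where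
  "path_between G u v xs \<longleftrightarrow> is_path G xs \<and> {hd xs, last xs} = {u, v}"

definition path_length :: "'a list \<Rightarrow> nat" where
  "path_length xs = length xs - 1"

definition shortest_path_between :: "'a graph \<Rightarrow> 'a \<Rightarrow> 'a \<Rightarrow> 'a list \<Rightarrow> bool" where
  "shortest_path_between G u v xs \<longleftrightarrow>
     path_between G u v xs \<and> (\<forall>ys. path_between G u v ys \<longrightarrow> path_length xs \<le> path_length ys)"

section \<open>Embeddings and wirelength\<close>

text \<open>
  An embedding is a pair of a vertex map \<open>f\<close> and a routing \<open>P\<close> that assigns a path to each edge.
  Only the values of \<open>f\<close> on \<open>verts G\<close> and of \<open>P\<close> on \<open>edges G\<close> matter.
\<close>

definition graph_embedding ::
    "'a graph \<Rightarrow> 'b graph \<Rightarrow> ('a \<Rightarrow> 'b) \<Rightarrow> ('a set \<Rightarrow> 'b list) \<Rightarrow> bool" where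
  "graph_embedding G H f P \<longleftrightarrow>
     inj_on f (verts G) \<and> f ` verts G \<subseteq> verts H \<and>
     (\<forall>x y. {x, y} \<in> edges G \<longrightarrow> path_between H (f x) (f y) (P {x, y}))"

definition embedding_wirelength :: "'a graph \<Rightarrow> ('a set \<Rightarrow> 'b list) \<Rightarrow> nat" where
  "embedding_wirelength G P = (\<Sum>e\<in>edges G. path_length (P e))"

text \<open>The value is unspecified if \<open>G\<close> has no embedding into \<open>H\<close>.\<close>

definition WL :: "'a graph \<Rightarrow> 'b graph \<Rightarrow> nat" where
  "WL G H = (LEAST w. \<exists>f P. graph_embedding G H f P \<and> w = embedding_wirelength G P)"

section \<open>Balanced complete multipartite graphs\<close>

text \<open>\<open>G\<close> is complete multipartite with \<open>k\<close> parts, the members of \<open>\<P>\<close>, all of size \<open>m\<close>.\<close>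

definition balanced_complete_multipartite ::
    "nat \<Rightarrow> nat \<Rightarrow> 'a graph \<Rightarrow> 'a set set \<Rightarrow> bool" where
  "balanced_complete_multipartite k m G \<P> \<longleftrightarrow>
     simple_graph G \<and> partition_on (verts G) \<P> \<and> card \<P> = k \<and> (\<forall>A\<in>\<P>. card A = m) \<and>
     edges G = {{x, y} | x y. \<exists>A\<in>\<P>. \<exists>B\<in>\<P>. A \<noteq> B \<and> x \<in> A \<and> y \<in> B}"

section \<open>The 1-rooted complete binary tree and its inorder labeling\<close>

text \<open>
  The vertices of the graph are the node contents, hence these must be pairwise distinct.
  The library's \<^const>\<open>height\<close> counts levels of (non-\<^const>\<open>Leaf\<close>) nodes.
\<close>

definition complete_binary_tree :: "nat \<Rightarrow> 'a tree \<Rightarrow> bool" where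
  "complete_binary_tree n t \<longleftrightarrow> complete t \<and> height t = n \<and> distinct (inorder t)"

fun root_set :: "'a tree \<Rightarrow> 'a set" where
  "root_set \<langle>\<rangle> = {}"
| "root_set \<langle>l, x, r\<rangle> = {x}"

fun tree_edges :: "'a tree \<Rightarrow> 'a set set" where
  "tree_edges \<langle>\<rangle> = {}"
| "tree_edges \<langle>l, x, r\<rangle> =
     {{x, y} | y. y \<in> root_set l \<union> root_set r} \<union> tree_edges l \<union> tree_edges r"

definition one_rooted_graph :: "'a tree \<Rightarrow> 'a \<Rightarrow> 'a graph" where
  "one_rooted_graph t \<rho> =
     \<lparr>verts = insert \<rho> (set_tree t), edges = {{\<rho>, y} | y. y \<in> root_set t} \<union> tree_edges t\<rparr>"

definition inorder_labeling :: "nat \<Rightarrow> 'a tree \<Rightarrow> 'a \<Rightarrow> ('a \<Rightarrow> nat) \<Rightarrow> bool" where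
  "inorder_labeling n t \<rho> lab \<longleftrightarrow> map lab (inorder t) = [1..<2 ^ n] \<and> lab \<rho> = 2 ^ n"

section \<open>The value of the wirelength\<close>

definition level_cost :: "nat \<Rightarrow> nat \<Rightarrow> nat \<Rightarrow> int" where
  "level_cost n p j =
     (if j \<le> p then (2 ^ j - 1) * (2 ^ (n - p) * (2 ^ p - 1) - (2 ^ j - 2))
      else (2 ^ p - 1) * (2 ^ (n - p) * (2 ^ j - 1) - 2 ^ (j - p) * (2 ^ j - 2)))"

end

theory Submission
  imports Defs
begin

text \<open>
  The host graph is itself the tree \<open>T\<close> with root \<open>\<rho>\<close>, left subtree \<open>t\<close> and empty right subtree,
  so its edges correspond to the nonempty subtrees \<open>s\<close> of \<open>t\<close>: the edge above \<open>s\<close> separates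
  \<open>set_tree s\<close> from the rest. Hence the distance of two vertices is the number of subtrees that
  contain exactly one of them (\<open>sep_le_path_length\<close>, \<open>path_of_length_sep\<close>). Exchanging the two
  summations, the wirelength of an embedding \<open>g\<close> is at least the sum over all \<open>s\<close> of the number of
  guest edges that leave the preimage of \<open>set_tree s\<close>, with equality when all routes are shortest
  (\<open>embedding_wirelength_ge_sum_edge_cut\<close>, \<open>embedding_wirelength_eq_sum_edge_cut\<close>). It is
  therefore enough to minimise every such cut separately.

  Since \<open>g\<close> is bijective, the preimage has exactly \<open>2 ^ j - 1\<close> vertices, where \<open>j\<close> is the height of
  \<open>s\<close>. In a complete multipartite graph with parts of size \<open>m\<close> on \<open>N\<close> vertices, a set with \<open>a\<close>
  vertices, \<open>a\<^sub>i\<close> of them in part \<open>i\<close>, is left by \<open>a * (N - m - a) + (\<Sum>i. a\<^sub>i\<^sup>2)\<close> edges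
  (\<open>card_edge_cut\<close>). For fixed \<open>a\<close> this is smallest when the \<open>a\<^sub>i\<close> take only two consecutive values
  \<open>q - 1\<close> and \<open>q\<close> (\<open>balanced_cut_le\<close>, \<open>balanced_cut_eq\<close>). Under the inorder labeling the vertices
  of a subtree carry consecutive labels, and the residues modulo \<open>2 ^ p\<close> of consecutive integers are
  evenly distributed; so the given embedding is balanced at every subtree at once
  (\<open>subtree_pullback_residues\<close>), with \<open>q = 2 ^ (j - p)\<close>. The truncated subtraction gives \<open>q = 1\<close>
  for \<open>j \<le> p\<close>, which merges the two cases in the definition of \<^const>\<open>level_cost\<close>. Finally, there are
  \<open>2 ^ (n - j)\<close> subtrees of height \<open>j\<close>.
\<close>

section \<open>Distances in a tree\<close>

fun nonempty_subtrees :: "'a tree \<Rightarrow> 'a tree list" where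
  "nonempty_subtrees \<langle>\<rangle> = []"
| "nonempty_subtrees \<langle>l, x, r\<rangle> = \<langle>l, x, r\<rangle> # nonempty_subtrees l @ nonempty_subtrees r"

definition tree_graph :: "'a tree \<Rightarrow> 'a graph" where
  "tree_graph t = \<lparr>verts = set_tree t, edges = tree_edges t\<rparr>"

definition depth :: "'a tree \<Rightarrow> 'a \<Rightarrow> nat" where
  "depth t u = (\<Sum>s\<leftarrow>nonempty_subtrees t. of_bool (u \<in> set_tree s))"

text \<open>Summing over the list of subtrees instead of the set of their vertex sets makes \<open>depth\<close> and
  \<open>sep\<close> obey plain recursion equations, with no overlap between the two children to exclude.\<close>

definition sep :: "'a tree \<Rightarrow> 'a \<Rightarrow> 'a \<Rightarrow> nat" where
  "sep t u v = (\<Sum>s\<leftarrow>nonempty_subtrees t. of_bool ((u \<in> set_tree s) \<noteq> (v \<in> set_tree s)))"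

lemma depth_simps [simp]:
  "depth \<langle>\<rangle> u = 0"
  "depth \<langle>l, x, r\<rangle> u = of_bool (u \<in> set_tree \<langle>l, x, r\<rangle>) + depth l u + depth r u"
  by (simp_all add: depth_def)

lemma sep_simps [simp]:
  "sep \<langle>\<rangle> u v = 0"
  "sep \<langle>l, x, r\<rangle> u v =
     of_bool ((u \<in> set_tree \<langle>l, x, r\<rangle>) \<noteq> (v \<in> set_tree \<langle>l, x, r\<rangle>)) + sep l u v + sep r u v"
  by (simp_all add: sep_def)

lemma depth_notin: "u \<notin> set_tree t \<Longrightarrow> depth t u = 0"
  by (induction t) auto

text \<open>This turns separation inside a child into depth as soon as one of the two vertices lies outside
  that child, which is how the mixed cases of the recursion are evaluated.\<close>

lemma sep_notin_right: "v \<notin> set_tree t \<Longrightarrow> sep t u v = depth t u"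
  by (induction t) auto

lemma sep_commute: "sep t u v = sep t v u"
  by (induction t) auto

lemma sep_notin_left: "u \<notin> set_tree t \<Longrightarrow> sep t u v = depth t v"
  using sep_notin_right sep_commute by metis

lemma sep_same [simp]: "sep t u u = 0"
  by (induction t) auto

lemma sep_triangle: "sep t u w \<le> sep t u v + sep t v w"
proof (induction t)
  case (Node l x r)
  have "of_bool ((u \<in> S) \<noteq> (w \<in> S)) \<le>
      of_bool ((u \<in> S) \<noteq> (v \<in> S)) + (of_bool ((v \<in> S) \<noteq> (w \<in> S)) :: nat)" for S
    by (simp add: of_bool_def)
  from add_mono [OF add_mono [OF this [of "set_tree \<langle>l, x, r\<rangle>"] Node.IH(1)] Node.IH(2)]
  show ?case by (simp only: sep_simps ac_simps)
qed simp

lemma root_in_tree: "y \<in> root_set t \<Longrightarrow> y \<in> set_tree t"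
  by (cases t) auto

lemma depth_root: "distinct (inorder t) \<Longrightarrow> y \<in> root_set t \<Longrightarrow> depth t y = 1"
  by (cases t) (auto simp: depth_notin)

lemma tree_edges_subset: "e \<in> tree_edges t \<Longrightarrow> e \<subseteq> set_tree t"
  by (induction t) (auto simp: root_in_tree)

text \<open>Deleting the edge between a vertex and its parent splits off exactly the subtree at that
  vertex, so an edge is separated by no other subtree.\<close>

lemma sep_edge:
  "distinct (inorder t) \<Longrightarrow> {u, v} \<in> tree_edges t \<Longrightarrow> sep t u v \<le> 1"
proof (induction t)
  case (Node l x r)
  have dl: "distinct (inorder l)" and dr: "distinct (inorder r)"
    and disj: "set_tree l \<inter> set_tree r = {}" "x \<notin> set_tree l" "x \<notin> set_tree r"
    using Node.prems(1) by auto
  have root_edge: "sep \<langle>l, x, r\<rangle> a b \<le> 1" if "b \<in> root_set l \<union> root_set r" "a = x" for a b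
  proof -
    have "sep l x b = depth l b" "sep r x b = depth r b"
      using disj by (simp_all add: sep_notin_left)
    moreover have "depth l b + depth r b = 1"
      using that(1) dl dr disj(1) depth_root depth_notin root_in_tree
      by (metis Un_iff add.right_neutral add_0 disjoint_iff)
    moreover have "b \<in> set_tree \<langle>l, x, r\<rangle>" using that(1) root_in_tree by fastforce
    ultimately show ?thesis using that(2) by simp
  qed
  consider (top) b where "b \<in> root_set l \<union> root_set r" "{u, v} = {x, b}"
    | (left) "{u, v} \<in> tree_edges l" | (right) "{u, v} \<in> tree_edges r"
    using Node.prems(2) by auto
  then show ?case
  proof cases
    case (top b)
    then have "u = x \<and> v = b \<or> u = b \<and> v = x" by (auto simp: doubleton_eq_iff)
    then show ?thesis using top(1) root_edge by (metis sep_commute)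
  next
    case left
    then have "u \<in> set_tree l" "v \<in> set_tree l" using tree_edges_subset by blast+
    moreover from this disj have "sep r u v = 0"
      by (metis depth_notin disjoint_iff sep_notin_left)
    ultimately show ?thesis using Node.IH(1) [OF dl left] by simp
  next
    case right
    then have "u \<in> set_tree r" "v \<in> set_tree r" using tree_edges_subset by blast+
    moreover from this disj have "sep l u v = 0"
      by (metis depth_notin disjoint_iff sep_notin_left)
    ultimately show ?thesis using Node.IH(2) [OF dr right] by simp
  qed
qed simp

text \<open>As a pseudometric that grows by at most one along each edge, \<open>sep\<close> bounds the length of every
  path from below.\<close>

lemma sep_le_path_length:
  assumes "distinct (inorder t)" "path_between (tree_graph t) u v xs"
  shows "sep t u v \<le> path_length xs"
proof -
  have *: "sep t (hd xs) (last xs) \<le> length xs - 1"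
    if "xs \<noteq> []" "successively (\<lambda>x y. {x, y} \<in> tree_edges t) xs" for xs
    using that
  proof (induction xs rule: induct_list012)
    case (3 x y zs)
    then show ?case
      using sep_triangle [of t x "last (y # zs)" y] sep_edge [OF assms(1), of x y] by simp
  qed simp_all
  have "xs \<noteq> []" "successively (\<lambda>x y. {x, y} \<in> tree_edges t) xs" "{hd xs, last xs} = {u, v}"
    using assms(2) by (auto simp: path_between_def is_path_def tree_graph_def)
  moreover from this(3) have "sep t (hd xs) (last xs) = sep t u v"
    by (auto simp: doubleton_eq_iff sep_commute)
  ultimately show ?thesis using * by (metis path_length_def)
qed

lemma is_path_mono:
  assumes "is_path G xs" "verts G \<subseteq> verts G'" "edges G \<subseteq> edges G'"
  shows "is_path G' xs"
  using assms by (auto simp: is_path_def elim: successively_mono)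

lemma is_path_rev: "is_path G xs \<Longrightarrow> is_path G (rev xs)"
  by (auto simp: is_path_def insert_commute elim: successively_mono)

lemma is_path_append:
  assumes "is_path G xs" "is_path G ys" "set xs \<inter> set ys = {}" "{last xs, hd ys} \<in> edges G"
  shows "is_path G (xs @ ys)"
  using assms by (auto simp: is_path_def successively_append_iff)

lemma is_path_tree_graph:
  assumes "is_path (tree_graph s) xs" "s = l \<or> s = r"
  shows "is_path (tree_graph \<langle>l, x, r\<rangle>) xs"
  by (rule is_path_mono [OF assms(1)]) (use assms(2) in \<open>auto simp: tree_graph_def\<close>)

text \<open>The climb from \<open>u\<close> passes through the roots of exactly the subtrees containing \<open>u\<close>; two such
  climbs are glued at a common ancestor below.\<close>

lemma path_to_root:
  assumes "distinct (inorder t)" "u \<in> set_tree t"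
  shows "\<exists>xs. is_path (tree_graph t) xs \<and> hd xs = u \<and> last xs \<in> root_set t \<and> length xs = depth t u"
  using assms
proof (induction t)
  case (Node l x r)
  have disj: "set_tree l \<inter> set_tree r = {}" "x \<notin> set_tree l" "x \<notin> set_tree r"
    using Node.prems(1) by auto
  have step: ?case if s: "s = l \<or> s = r" "u \<in> set_tree s"
      "is_path (tree_graph s) xs" "hd xs = u" "last xs \<in> root_set s" "length xs = depth s u" for s xs
  proof (intro exI conjI)
    have xs: "xs \<noteq> []" "set xs \<subseteq> set_tree s" using s(3) by (auto simp: is_path_def tree_graph_def)
    show "is_path (tree_graph \<langle>l, x, r\<rangle>) (xs @ [x])"
    proof (rule is_path_append)
      show "is_path (tree_graph \<langle>l, x, r\<rangle>) xs" using is_path_tree_graph s(1,3) by metis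
      show "is_path (tree_graph \<langle>l, x, r\<rangle>) [x]" by (simp add: is_path_def tree_graph_def)
      show "set xs \<inter> set [x] = {}" using xs s(1) disj by auto
      show "{last xs, hd [x]} \<in> edges (tree_graph \<langle>l, x, r\<rangle>)"
        using s(1,5) by (auto simp: tree_graph_def insert_commute)
    qed
    show "hd (xs @ [x]) = u" using xs s(4) by simp
    show "last (xs @ [x]) \<in> root_set \<langle>l, x, r\<rangle>" by simp
    show "length (xs @ [x]) = depth \<langle>l, x, r\<rangle> u"
      using s(1,2,6) disj(1) by (auto simp: depth_notin disjoint_iff)
  qed
  consider "u = x" | "u \<in> set_tree l" | "u \<in> set_tree r" using Node.prems by auto
  then show ?case
  proof cases
    case 1
    then show ?thesis using disj
      by (intro exI [of _ "[x]"]) (simp add: is_path_def tree_graph_def depth_notin)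
  next
    case 2
    then show ?thesis using Node.IH(1) Node.prems(1) step [of l] by auto
  next
    case 3
    then show ?thesis using Node.IH(2) Node.prems(1) step [of r] by auto
  qed
qed simp

text \<open>Every subtree that separates \<open>u\<close> from \<open>v\<close> has its top edge on the route that climbs
  from \<open>u\<close> to the lowest common ancestor and descends to \<open>v\<close>; so the lower bound by \<open>sep\<close> is attained.\<close>

lemma path_of_length_sep:
  assumes "distinct (inorder t)" "u \<in> set_tree t" "v \<in> set_tree t"
  shows "\<exists>xs. is_path (tree_graph t) xs \<and> hd xs = u \<and> last xs = v \<and> length xs = Suc (sep t u v)"
  using assms
proof (induction t arbitrary: u v)
  case (Node l x r)
  let ?G = "tree_graph \<langle>l, x, r\<rangle>"
  have d: "distinct (inorder l)" "distinct (inorder r)"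
    and disj: "set_tree l \<inter> set_tree r = {}" "x \<notin> set_tree l" "x \<notin> set_tree r"
    using Node.prems(1) by auto
  let ?good = "\<lambda>u v. \<exists>xs. is_path ?G xs \<and> hd xs = u \<and> last xs = v \<and> length xs = Suc (sep \<langle>l, x, r\<rangle> u v)"
  have sym: "?good u v" if vu: "?good v u" for u v
  proof -
    obtain xs where "is_path ?G xs" "hd xs = v" "last xs = u" "length xs = Suc (sep \<langle>l, x, r\<rangle> v u)"
      using vu by blast
    then show ?thesis
      by (intro exI [of _ "rev xs"]) (metis hd_rev is_path_rev last_rev length_rev sep_commute)
  qed
  have same: "?good u v" if s: "s = l \<or> s = r" "u \<in> set_tree s" "v \<in> set_tree s"
    "\<exists>xs. is_path (tree_graph s) xs \<and> hd xs = u \<and> last xs = v \<and> length xs = Suc (sep s u v)" for s u v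
  proof -
    have "sep \<langle>l, x, r\<rangle> u v = sep s u v"
      using s(1)
    proof
      assume "s = l"
      moreover from this have "u \<notin> set_tree r" "v \<notin> set_tree r" using s(2,3) disj(1) by auto
      ultimately show ?thesis using s(2,3) by (simp add: sep_notin_left depth_notin)
    next
      assume "s = r"
      moreover from this have "u \<notin> set_tree l" "v \<notin> set_tree l" using s(2,3) disj(1) by auto
      ultimately show ?thesis using s(2,3) by (simp add: sep_notin_left depth_notin)
    qed
    then show ?thesis using s(1,4) is_path_tree_graph by metis
  qed
  have root: "?good x v" if v: "v \<in> set_tree \<langle>l, x, r\<rangle>" for v
  proof -
    have "sep \<langle>l, x, r\<rangle> x v = depth l v + depth r v"
      using v disj by (simp add: sep_notin_left)
    then have "Suc (sep \<langle>l, x, r\<rangle> v x) = depth \<langle>l, x, r\<rangle> v"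
      using v by (simp add: sep_commute [of _ v x] del: sep_simps)
    then have "?good v x"
      using path_to_root [OF Node.prems(1) v] by simp
    then show ?thesis by (rule sym)
  qed
  have across: "?good u v" if uv: "u \<in> set_tree l" "v \<in> set_tree r" for u v
  proof -
    obtain xs ys where xs: "is_path (tree_graph l) xs" "hd xs = u" "last xs \<in> root_set l"
        "length xs = depth l u"
      and ys: "is_path (tree_graph r) ys" "hd ys = v" "last ys \<in> root_set r"
        "length ys = depth r v"
      using path_to_root d uv by metis
    have ne: "xs \<noteq> []" "ys \<noteq> []" "set xs \<subseteq> set_tree l" "set ys \<subseteq> set_tree r"
      using xs(1) ys(1) by (auto simp: is_path_def tree_graph_def)
    have x: "is_path ?G [x]" by (simp add: is_path_def tree_graph_def)
    have "is_path ?G ([x] @ rev ys)"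
      by (rule is_path_append [OF x is_path_rev [OF is_path_tree_graph [OF ys(1) disjI2 [OF refl]]]])
        (use ne disj ys(3) in \<open>auto simp: hd_rev tree_graph_def\<close>)
    then have "is_path ?G (xs @ [x] @ rev ys)"
      by (rule is_path_append [OF is_path_tree_graph [OF xs(1) disjI1 [OF refl]]])
        (use ne disj xs(3) in \<open>auto simp: tree_graph_def insert_commute\<close>)
    moreover have "v \<notin> set_tree l" "u \<notin> set_tree r" using uv disj(1) by auto
    ultimately show ?thesis using ne xs ys uv
      by (intro exI [of _ "xs @ [x] @ rev ys"]) (simp add: last_rev sep_notin_left sep_notin_right)
  qed
  consider "u = x" | "v = x" | "u \<in> set_tree l" "v \<in> set_tree l" | "u \<in> set_tree r" "v \<in> set_tree r"
    | "u \<in> set_tree l" "v \<in> set_tree r" | "u \<in> set_tree r" "v \<in> set_tree l"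
    using Node.prems(2,3) by auto
  then show ?case
  proof cases
    case 1 then show ?thesis using root Node.prems(3) by blast
  next
    case 2 then show ?thesis using root sym Node.prems(2) by blast
  next
    case 3 then show ?thesis using same [of l] Node.IH(1) d(1) by blast
  next
    case 4 then show ?thesis using same [of r] Node.IH(2) d(2) by blast
  next
    case 5 then show ?thesis by (rule across)
  next
    case 6 then show ?thesis using across sym by blast
  qed
qed simp

lemma shortest_path_length:
  assumes "distinct (inorder t)" "u \<in> set_tree t" "v \<in> set_tree t"
    "shortest_path_between (tree_graph t) u v xs"
  shows "path_length xs = sep t u v"
proof (rule antisym)
  obtain ys where ys: "is_path (tree_graph t) ys" "hd ys = u" "last ys = v"
      "length ys = Suc (sep t u v)"
    using path_of_length_sep [OF assms(1-3)] by blast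
  then have "path_between (tree_graph t) u v ys" by (simp add: path_between_def)
  then have "path_length xs \<le> path_length ys"
    using assms(4) by (simp add: shortest_path_between_def)
  then show "path_length xs \<le> sep t u v" using ys(4) by (simp add: path_length_def)
  show "sep t u v \<le> path_length xs"
    using sep_le_path_length [OF assms(1)] assms(4) by (simp add: shortest_path_between_def)
qed

section \<open>Wirelength as a sum of edge cuts\<close>

definition edge_cut :: "'a graph \<Rightarrow> 'a set \<Rightarrow> 'a set set" where
  "edge_cut G A = {e \<in> edges G. e \<inter> A \<noteq> {} \<and> e - A \<noteq> {}}"

definition pullback :: "'a graph \<Rightarrow> ('a \<Rightarrow> 'b) \<Rightarrow> 'b set \<Rightarrow> 'a set" where
  "pullback G f S = {x \<in> verts G. f x \<in> S}"

lemma sum_sum_list_swap: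
  "finite E \<Longrightarrow> (\<Sum>e\<in>E. \<Sum>s\<leftarrow>ss. h e s) = (\<Sum>s\<leftarrow>ss. \<Sum>e\<in>E. h e s :: nat)"
  by (induction ss) (simp_all add: sum.distrib)

lemma int_sum_list: "int (\<Sum>x\<leftarrow>xs. h x) = (\<Sum>x\<leftarrow>xs. int (h x))"
  by (induction xs) simp_all

lemma finite_edges: "simple_graph G \<Longrightarrow> finite (edges G)"
  unfolding simple_graph_def by (meson PowI finite_Pow_iff finite_subset subsetI)

lemma simple_edge:
  assumes "simple_graph G" "e \<in> edges G"
  obtains x y where "e = {x, y}" "x \<in> verts G" "y \<in> verts G"
  using assms unfolding simple_graph_def card_2_iff by (metis insert_subset)

text \<open>Double counting of the pairs of a guest edge and a subtree that separates the images of its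
  ends.\<close>

lemma sum_sep_eq_sum_edge_cut:
  assumes "simple_graph G"
    and L: "\<And>x y. {x, y} \<in> edges G \<Longrightarrow> L {x, y} = sep t (g x) (g y)"
  shows "(\<Sum>e\<in>edges G. L e) =
    (\<Sum>s\<leftarrow>nonempty_subtrees t. card (edge_cut G (pullback G g (set_tree s))))"
proof -
  have "L e = (\<Sum>s\<leftarrow>nonempty_subtrees t. of_bool (e \<in> edge_cut G (pullback G g (set_tree s))))"
    if e: "e \<in> edges G" for e
  proof -
    obtain x y where xy: "e = {x, y}" "x \<in> verts G" "y \<in> verts G"
      using simple_edge assms(1) e by metis
    then have "e \<in> edge_cut G (pullback G g S) \<longleftrightarrow> (g x \<in> S) \<noteq> (g y \<in> S)" for S
      using e by (auto simp: edge_cut_def pullback_def)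
    then show ?thesis using L e xy(1) by (simp add: sep_def)
  qed
  then have "(\<Sum>e\<in>edges G. L e) =
      (\<Sum>s\<leftarrow>nonempty_subtrees t. \<Sum>e\<in>edges G. of_bool (e \<in> edge_cut G (pullback G g (set_tree s))))"
    using finite_edges [OF assms(1)] by (simp add: sum_sum_list_swap)
  moreover have "(\<Sum>e\<in>edges G. of_bool (e \<in> edge_cut G A)) = card (edge_cut G A)" for A
    using finite_edges [OF assms(1)] by (simp add: edge_cut_def Int_def)
  ultimately show ?thesis by simp
qed

lemma embedding_wirelength_ge_sum_edge_cut:
  assumes "simple_graph G" "distinct (inorder t)" "graph_embedding G (tree_graph t) g Q"
  shows "(\<Sum>s\<leftarrow>nonempty_subtrees t. card (edge_cut G (pullback G g (set_tree s))))
    \<le> embedding_wirelength G Q"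
proof -
  \<comment> \<open>\<open>sep\<close> is symmetric, so it descends from ordered pairs to edges, whatever choice is made.\<close>
  define L where "L e = (SOME k. \<exists>x y. e = {x, y} \<and> k = sep t (g x) (g y))" for e
  have L: "L {x, y} = sep t (g x) (g y)" for x y
  proof -
    have "\<exists>x' y'. {x, y} = {x', y'} \<and> L {x, y} = sep t (g x') (g y')"
      unfolding L_def by (rule someI_ex) blast
    then show ?thesis by (auto simp: doubleton_eq_iff sep_commute)
  qed
  have "(\<Sum>e\<in>edges G. L e) \<le> embedding_wirelength G Q"
    unfolding embedding_wirelength_def
  proof (rule sum_mono)
    fix e assume e: "e \<in> edges G"
    then obtain x y where "e = {x, y}" using simple_edge assms(1) by metis
    then show "L e \<le> path_length (Q e)"
      using e L sep_le_path_length [OF assms(2)] assms(3) by (simp add: graph_embedding_def)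
  qed
  then show ?thesis using sum_sep_eq_sum_edge_cut [OF assms(1), of L t g] L by simp
qed

lemma embedding_wirelength_eq_sum_edge_cut:
  assumes "simple_graph G" "distinct (inorder t)" "f ` verts G \<subseteq> set_tree t"
    and "\<And>x y. {x, y} \<in> edges G \<Longrightarrow> shortest_path_between (tree_graph t) (f x) (f y) (P {x, y})"
  shows "embedding_wirelength G P =
    (\<Sum>s\<leftarrow>nonempty_subtrees t. card (edge_cut G (pullback G f (set_tree s))))"
  unfolding embedding_wirelength_def
proof (rule sum_sep_eq_sum_edge_cut [OF assms(1)])
  fix x y assume e: "{x, y} \<in> edges G"
  then have "x \<in> verts G" "y \<in> verts G"
    using assms(1) by (auto simp: simple_graph_def)
  then have "f x \<in> set_tree t" "f y \<in> set_tree t"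
    using assms(3) by auto
  then show "path_length (P {x, y}) = sep t (f x) (f y)"
    using shortest_path_length assms(2,4) e by metis
qed

section \<open>Edge cuts of balanced complete multipartite graphs\<close>

text \<open>Describing the parts by a colour function \<open>c\<close> lets sums over parts run over \<open>{..<k}\<close>.\<close>

locale colour_classes =
  fixes G :: "'a graph" and c :: "'a \<Rightarrow> nat" and k m :: nat
  assumes finite_verts: "finite (verts G)"
    and edges_eq: "edges G = {{x, y} | x y. x \<in> verts G \<and> y \<in> verts G \<and> c x \<noteq> c y}"
    and colour_less: "x \<in> verts G \<Longrightarrow> c x < k"
    and card_class: "i < k \<Longrightarrow> card {x \<in> verts G. c x = i} = m"
begin

lemma sum_by_colour:
  assumes "A \<subseteq> verts G"
  shows "(\<Sum>x\<in>A. h (c x)) = (\<Sum>i<k. int (card {x \<in> A. c x = i}) * h i)"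
proof -
  have "finite A" using assms finite_verts finite_subset by blast
  moreover have "c ` A \<subseteq> {..<k}" using assms colour_less by auto
  ultimately have "(\<Sum>x\<in>A. h (c x)) = (\<Sum>i<k. \<Sum>x\<in>{x \<in> A. c x = i}. h (c x))"
    using sum.group [of A "{..<k}" c "\<lambda>x. h (c x)"] by simp
  then show ?thesis by simp
qed

text \<open>A vertex of colour \<open>i\<close> in \<open>A\<close> is joined to all vertices outside \<open>A\<close> and outside its own class
  of size \<open>m\<close>; by inclusion-exclusion there are \<open>N - m - card A + a\<^sub>i\<close> of them, where \<open>N\<close> is the number
  of all vertices and \<open>a\<^sub>i\<close> the number of vertices of colour \<open>i\<close> in \<open>A\<close>. Summing \<open>a\<^sub>i\<close> over the vertices
  of \<open>A\<close> produces the squares.\<close>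

lemma card_edge_cut:
  assumes A: "A \<subseteq> verts G"
  shows "int (card (edge_cut G A)) = int (card A) * (int (card (verts G)) - int m - int (card A))
    + (\<Sum>i<k. (int (card {x \<in> A. c x = i}))\<^sup>2)"
proof -
  have finA: "finite A" using A finite_verts finite_subset by blast
  \<comment> \<open>A cut edge has exactly one end in \<open>A\<close>, which orients it.\<close>
  let ?X = "SIGMA x:A. {y \<in> verts G - A. c y \<noteq> c x}"
  have "edge_cut G A = (\<lambda>(x, y). {x, y}) ` ?X"
  proof (intro equalityI subsetI)
    fix e assume "e \<in> edge_cut G A"
    then obtain x y where e: "e = {x, y}" "x \<in> verts G" "y \<in> verts G" "c x \<noteq> c y"
        "e \<inter> A \<noteq> {}" "e - A \<noteq> {}"
      unfolding edge_cut_def edges_eq by auto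
    then have "(x, y) \<in> ?X \<or> (y, x) \<in> ?X" by auto
    then show "e \<in> (\<lambda>(x, y). {x, y}) ` ?X"
      using e(1) by (metis (no_types, lifting) case_prod_conv image_eqI insert_commute)
  next
    fix e assume "e \<in> (\<lambda>(x, y). {x, y}) ` ?X"
    then obtain x y where e: "e = {x, y}" "x \<in> A" "y \<in> verts G" "y \<notin> A" "c y \<noteq> c x" by auto
    then have "e \<in> edges G" unfolding edges_eq using A by force
    then show "e \<in> edge_cut G A" using e by (auto simp: edge_cut_def)
  qed
  moreover have "inj_on (\<lambda>(x, y). {x, y}) ?X"
    by (auto simp: inj_on_def doubleton_eq_iff)
  ultimately have "card (edge_cut G A) = card ?X" by (simp add: card_image)
  also have "\<dots> = (\<Sum>x\<in>A. card {y \<in> verts G - A. c y \<noteq> c x})"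
    using finA finite_verts by simp
  finally have "int (card (edge_cut G A)) = (\<Sum>x\<in>A. int (card {y \<in> verts G - A. c y \<noteq> c x}))"
    by simp
  also have "\<dots> = (\<Sum>x\<in>A. int (card (verts G)) - int m - int (card A)
      + int (card {y \<in> A. c y = c x}))"
  proof (rule sum.cong [OF refl])
    fix x assume x: "x \<in> A"
    let ?F = "{y \<in> verts G. c y = c x}"
    have F: "card ?F = m" "finite ?F" using x A colour_less card_class finite_verts by auto
    have "card A + card ?F = card (A \<union> ?F) + card (A \<inter> ?F)"
      by (rule card_Un_Int [OF finA F(2)])
    moreover have "card (A \<inter> ?F) = card {y \<in> A. c y = c x}"
      using A by (intro arg_cong [of _ _ card]) auto
    moreover have "card (A \<union> ?F) + card {y \<in> verts G - A. c y \<noteq> c x} = card (verts G)"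
    proof -
      have "verts G = (A \<union> ?F) \<union> {y \<in> verts G - A. c y \<noteq> c x}" using A by auto
      then show ?thesis
        using card_Un_disjoint [of "A \<union> ?F" "{y \<in> verts G - A. c y \<noteq> c x}"] finA finite_verts
        by fastforce
    qed
    ultimately show "int (card {y \<in> verts G - A. c y \<noteq> c x}) =
        int (card (verts G)) - int m - int (card A) + int (card {y \<in> A. c y = c x})"
      using F(1) by linarith
  qed
  also have "\<dots> = int (card A) * (int (card (verts G)) - int m - int (card A))
      + (\<Sum>x\<in>A. int (card {y \<in> A. c y = c x}))"
    by (simp add: sum.distrib)
  also have "(\<Sum>x\<in>A. int (card {y \<in> A. c y = c x})) = (\<Sum>i<k. (int (card {x \<in> A. c x = i}))\<^sup>2)"
    using sum_by_colour [OF A, of "\<lambda>i. int (card {y \<in> A. c y = i})"] by (simp add: power2_eq_square)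
  finally show ?thesis .
qed

lemma card_eq_sum_classes:
  assumes "A \<subseteq> verts G"
  shows "int (card A) = (\<Sum>i<k. int (card {x \<in> A. c x = i}))"
  using sum_by_colour [OF assms, of "\<lambda>_. 1"] by simp

text \<open>The cut size from the formula above for a set of size \<open>a\<close> whose classes all have size \<open>q - 1\<close> or
  \<open>q\<close>: the second summand is then the sum of the squares.\<close>

definition balanced_cut :: "int \<Rightarrow> int \<Rightarrow> int" where
  "balanced_cut q a = a * (int (card (verts G)) - int m - a) + ((2 * q - 1) * a - int k * (q * (q - 1)))"

text \<open>No integer lies strictly between \<open>q - 1\<close> and \<open>q\<close>, so \<open>(a - q) * (a - q + 1) \<ge> 0\<close> for every
  integer \<open>a\<close>. This linear lower bound for \<open>a\<^sup>2\<close>, summed over the colour classes, depends only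
  on the size of the set. Equality holds when every class has size \<open>q - 1\<close> or \<open>q\<close>.\<close>

lemma balanced_cut_le:
  assumes "A \<subseteq> verts G"
  shows "balanced_cut q (int (card A)) \<le> int (card (edge_cut G A))"
proof -
  have "(2 * q - 1) * a - q * (q - 1) \<le> a\<^sup>2" for a :: int
  proof -
    have "0 \<le> (a - q) * (a - q + 1)"
      by (cases "a < q") (simp_all add: mult_nonpos_nonpos)
    then show ?thesis by (simp add: power2_eq_square algebra_simps)
  qed
  then have "(\<Sum>i<k. (2 * q - 1) * int (card {x \<in> A. c x = i}) - q * (q - 1))
      \<le> (\<Sum>i<k. (int (card {x \<in> A. c x = i}))\<^sup>2)"
    by (intro sum_mono)
  then show ?thesis
    by (simp add: card_edge_cut [OF assms] balanced_cut_def sum_subtractf card_eq_sum_classes [OF assms]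
        flip: sum_distrib_left)
qed

lemma balanced_cut_eq:
  assumes "A \<subseteq> verts G"
    and "\<And>i. i < k \<Longrightarrow> int (card {x \<in> A. c x = i}) \<in> {q - 1, q}"
  shows "int (card (edge_cut G A)) = balanced_cut q (int (card A))"
proof -
  have "(2 * q - 1) * a - q * (q - 1) = a\<^sup>2" if "a \<in> {q - 1, q}" for a :: int
    using that by (auto simp: power2_eq_square algebra_simps)
  then have "(\<Sum>i<k. (2 * q - 1) * int (card {x \<in> A. c x = i}) - q * (q - 1))
      = (\<Sum>i<k. (int (card {x \<in> A. c x = i}))\<^sup>2)"
    using assms(2) by (intro sum.cong) auto
  then show ?thesis
    by (simp add: card_edge_cut [OF assms(1)] balanced_cut_def sum_subtractf
        card_eq_sum_classes [OF assms(1)] flip: sum_distrib_left)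
qed

end

lemma balanced_multipartite_colour_classes:
  assumes "balanced_complete_multipartite k m G {{x \<in> verts G. c x = i} | i. i < k}"
    and "\<And>x. x \<in> verts G \<Longrightarrow> c x < k"
  shows "colour_classes G c k m"
proof
  define F where "F i = {x \<in> verts G. c x = i}" for i
  define \<P> where "\<P> = {F i | i. i < k}"
  have G: "simple_graph G" "\<forall>A\<in>\<P>. card A = m"
    "edges G = {{x, y} | x y. \<exists>A\<in>\<P>. \<exists>B\<in>\<P>. A \<noteq> B \<and> x \<in> A \<and> y \<in> B}"
    using assms(1) unfolding balanced_complete_multipartite_def F_def [symmetric] \<P>_def [symmetric]
    by - (elim conjE, assumption)+
  have F_in: "F i \<in> \<P>" if "i < k" for i using that unfolding \<P>_def by blast
  show "finite (verts G)" using G(1) by (simp add: simple_graph_def)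
  show "card {x \<in> verts G. c x = i} = m" if "i < k" for i
    using bspec [OF G(2) F_in [OF that]] by (simp only: F_def)
  have "(\<exists>A\<in>\<P>. \<exists>B\<in>\<P>. A \<noteq> B \<and> x \<in> A \<and> y \<in> B)
      \<longleftrightarrow> x \<in> verts G \<and> y \<in> verts G \<and> c x \<noteq> c y" (is "?L x y \<longleftrightarrow> ?R x y") for x y
  proof
    assume "?L x y" then show "?R x y" by (auto simp: \<P>_def F_def)
  next
    assume R: "?R x y"
    have "x \<in> F (c x)" "y \<in> F (c y)" "x \<notin> F (c y)" using R by (simp_all add: F_def)
    moreover from this have "F (c x) \<noteq> F (c y)" by metis
    ultimately show "?L x y" using F_in R assms(2) by metis
  qed
  then show "edges G = {{x, y} | x y. x \<in> verts G \<and> y \<in> verts G \<and> c x \<noteq> c y}"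
    by (simp only: G(3))
qed (rule assms(2))

section \<open>Subtrees of the complete tree and the inorder labeling\<close>

lemma complete_subtree:
  "complete t \<Longrightarrow> s \<in> set (nonempty_subtrees t) \<Longrightarrow> complete s"
  by (induction t) auto

lemma distinct_subtree:
  "distinct (inorder t) \<Longrightarrow> s \<in> set (nonempty_subtrees t) \<Longrightarrow> distinct (inorder s)"
  by (induction t) auto

lemma subtree_subset:
  "s \<in> set (nonempty_subtrees t) \<Longrightarrow> set_tree s \<subseteq> set_tree t"
  by (induction t) auto

lemma card_complete_tree:
  assumes "complete t" "distinct (inorder t)"
  shows "card (set_tree t) = 2 ^ height t - 1"
  using assms distinct_card [OF assms(2)] size_if_complete by fastforce

lemma sum_subtrees_complete:
  fixes h :: "nat \<Rightarrow> int"
  assumes "complete t"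
  shows "(\<Sum>s\<leftarrow>nonempty_subtrees t. h (height s)) = (\<Sum>j = 1..height t. 2 ^ (height t - j) * h j)"
  using assms
proof (induction t)
  case (Node l x r)
  then have eq: "height r = height l" by simp
  have "(\<Sum>j = 1..Suc (height l). 2 ^ (Suc (height l) - j) * h j)
      = (\<Sum>j = 1..height l. 2 * (2 ^ (height l - j) * h j)) + h (Suc (height l))"
    by (simp add: Suc_diff_le mult.assoc)
  also have "\<dots> = 2 * (\<Sum>j = 1..height l. 2 ^ (height l - j) * h j) + h (Suc (height l))"
    by (simp only: sum_distrib_left)
  finally show ?case using Node eq by simp
qed simp

lemma upt_eq_append:
  assumes "[a..<b] = xs @ ys" "a \<le> b"
  obtains k where "a \<le> k" "k \<le> b" "xs = [a..<k]" "ys = [k..<b]"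
proof
  have len: "length xs + length ys = b - a"
    using arg_cong [OF assms(1), of length] by simp
  then show "a \<le> a + length xs" "a + length xs \<le> b" using assms(2) by auto
  then have "take (length xs) [a..<b] = [a..<a + length xs]" by simp
  then show "xs = [a..<a + length xs]" using assms(1) by simp
  have "drop (length xs) [a..<b] = [a + length xs..<b]" by simp
  then show "ys = [a + length xs..<b]" using assms(1) by simp
qed

text \<open>Inorder traversal lists every subtree as a contiguous block, between whatever precedes and
  follows it in the traversal of the whole tree.\<close>

lemma subtree_labels_interval:
  assumes "map lab (inorder t) = [a..<b]" "s \<in> set (nonempty_subtrees t)"
  shows "\<exists>a' b'. a \<le> a' \<and> a' \<le> b' \<and> b' \<le> b \<and> lab ` set_tree s = {a'..<b'}"
  using assms
proof (induction t arbitrary: a b)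
  case (Node l x r)
  have "length [a..<b] \<noteq> 0" by (simp flip: Node.prems(1))
  then have "a < b" by simp
  then obtain k where k: "a \<le> k" "k \<le> b" "map lab (inorder l) = [a..<k]"
      "lab x # map lab (inorder r) = [k..<b]"
    using upt_eq_append [of a b "map lab (inorder l)" "lab x # map lab (inorder r)"] Node.prems(1)
    by auto
  then have r: "map lab (inorder r) = [Suc k..<b]" by (metis list.sel(3) tl_upt)
  consider "s = \<langle>l, x, r\<rangle>" | "s \<in> set (nonempty_subtrees l)" | "s \<in> set (nonempty_subtrees r)"
    using Node.prems(2) by auto
  then show ?case
  proof cases
    case 1
    have "lab ` set_tree \<langle>l, x, r\<rangle> = set (map lab (inorder \<langle>l, x, r\<rangle>))"
      by (simp only: set_map set_inorder)
    also have "\<dots> = {a..<b}" by (simp only: Node.prems(1) set_upt)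
    finally show ?thesis using 1 \<open>a < b\<close> by fastforce
  next
    case 2
    then show ?thesis using Node.IH(1) [OF k(3)] k(2) by (meson order_trans)
  next
    case 3
    then show ?thesis using Node.IH(2) [OF r] k(1) by (meson Suc_leD order_trans)
  qed
qed simp

text \<open>Any \<open>k\<close> consecutive integers represent every residue modulo \<open>k\<close> once, wherever they
  start, so each period adds one element.\<close>

lemma card_residue_block:
  fixes c k s q :: nat
  assumes "c < k"
  shows "card {x \<in> {s..<s + q * k}. x mod k = c} = q"
proof (induction q)
  case (Suc q)
  let ?t = "s + q * k"
  have inj: "inj_on (\<lambda>x. x mod k) {?t..<?t + k}"
  proof (rule inj_onI)
    fix x y assume xy: "x \<in> {?t..<?t + k}" "y \<in> {?t..<?t + k}" "x mod k = y mod k"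
    have "int x mod int k = int y mod int k" using xy(3) by (simp flip: zmod_int)
    then have "int k dvd int x - int y" by (simp add: mod_eq_dvd_iff)
    moreover have "\<bar>int x - int y\<bar> < int k" using xy(1,2) by auto
    ultimately have "int x - int y = 0"
      using dvd_imp_le_int [of "int x - int y" "int k"] by linarith
    then show "x = y" by simp
  qed
  moreover have "(\<lambda>x. x mod k) ` {?t..<?t + k} = {..<k}"
    using assms by (intro card_subset_eq) (auto simp: card_image [OF inj])
  ultimately have bij: "bij_betw (\<lambda>x. x mod k) {?t..<?t + k} {..<k}"
    by (simp add: bij_betw_def)
  then obtain z where z: "z \<in> {?t..<?t + k}" "z mod k = c"
    using assms by (metis bij_betw_def imageE lessThan_iff)
  have "{x \<in> {?t..<?t + k}. x mod k = c} = {z}"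
    using z inj_onD [OF bij_betw_imp_inj_on [OF bij]] by blast
  moreover have "{x \<in> {s..<s + Suc q * k}. x mod k = c} =
      {x \<in> {s..<?t}. x mod k = c} \<union> {x \<in> {?t..<?t + k}. x mod k = c}"
    by auto
  moreover have "card ({x \<in> {s..<?t}. x mod k = c} \<union> {x \<in> {?t..<?t + k}. x mod k = c}) =
      card {x \<in> {s..<?t}. x mod k = c} + card {x \<in> {?t..<?t + k}. x mod k = c}"
    by (rule card_Un_disjoint) auto
  ultimately show ?case
    using Suc.IH by simp
qed simp

text \<open>The count is monotone in the interval, so it lies between the exact counts for the two
  neighbouring multiples of the period.\<close>

lemma card_residue_interval:
  fixes i k a b q :: nat
  assumes "i < k" "(q - 1) * k \<le> b - a" "b - a \<le> q * k" "a \<le> b" "1 \<le> q"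
  shows "int (card {x \<in> {a..<b}. x mod k = i}) \<in> {int q - 1, int q}"
proof -
  let ?C = "\<lambda>b. card {x \<in> {a..<b}. x mod k = i}"
  have "?C (a + (q - 1) * k) \<le> ?C b" "?C b \<le> ?C (a + q * k)"
    using assms(2-4) by (intro card_mono; auto)+
  then have "q - 1 \<le> ?C b" "?C b \<le> q" using card_residue_block [OF assms(1)] by simp_all
  then show ?thesis using assms(5) by auto
qed

lemma card_pullback:
  assumes "bij_betw g (verts G) W" "S \<subseteq> W"
  shows "card (pullback G g S) = card S"
proof -
  have "inj_on g (pullback G g S)"
    using assms(1) by (auto simp: bij_betw_def pullback_def inj_on_def)
  moreover have "g ` pullback G g S = S"
    using assms by (auto simp: bij_betw_def pullback_def)
  ultimately have "bij_betw g (pullback G g S) S" by (simp add: bij_betw_def)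
  then show ?thesis by (rule bij_betw_same_card)
qed

text \<open>A label-preserving map transports the interval of labels of a subtree back to the guest, where
  the parts are residue classes, so the preimage of the subtree is balanced.\<close>

lemma subtree_pullback_residues:
  assumes "map lab (inorder t) = [1..<N]" "s \<in> set (nonempty_subtrees t)"
    and labG: "bij_betw labG (verts G) M" "{1..<N} \<subseteq> M"
    and f: "\<And>x. x \<in> verts G \<Longrightarrow> f x \<in> W \<and> lab (f x) = labG x"
    and W: "set_tree t \<subseteq> W" "inj_on lab W"
    and i: "i < k" and q: "(q - 1) * k \<le> card (set_tree s)" "card (set_tree s) \<le> q * k" "1 \<le> q"
  shows "int (card {x \<in> pullback G f (set_tree s). labG x mod k = i}) \<in> {int q - 1, int q}"
proof -
  obtain a b where ab: "1 \<le> a" "a \<le> b" "b \<le> N" "lab ` set_tree s = {a..<b}"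
    using subtree_labels_interval [OF assms(1,2)] by blast
  have sW: "set_tree s \<subseteq> W" using subtree_subset [OF assms(2)] W(1) by blast
  then have card_s: "card (set_tree s) = b - a"
    using card_image [OF inj_on_subset [OF W(2)], of "set_tree s"] ab(4) by simp
  have mem: "f x \<in> set_tree s \<longleftrightarrow> labG x \<in> {a..<b}" if "x \<in> verts G" for x
    using inj_on_image_mem_iff [OF W(2) _ sW, of "f x"] f [OF that] ab(4) by simp
  let ?A = "{x \<in> pullback G f (set_tree s). labG x mod k = i}"
  have "labG ` ?A = {y \<in> {a..<b}. y mod k = i}"
  proof (intro equalityI subsetI)
    fix y assume y: "y \<in> {y \<in> {a..<b}. y mod k = i}"
    then have "y \<in> M" using ab(1,3) labG(2) by auto
    then obtain x where "x \<in> verts G" "y = labG x" using labG(1) by (auto simp: bij_betw_def)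
    then show "y \<in> labG ` ?A" using y mem by (auto simp: pullback_def)
  qed (use mem in \<open>auto simp: pullback_def\<close>)
  moreover have "inj_on labG ?A"
    using labG(1) by (auto simp: bij_betw_def pullback_def inj_on_def)
  ultimately have "card ?A = card {y \<in> {a..<b}. y mod k = i}"
    using card_image [of labG ?A] by simp
  then show ?thesis
    using card_residue_interval [OF i q(1,2) [unfolded card_s] ab(2) q(3)] by simp
qed

lemma (in colour_classes) balanced_cut_eq_level_cost:
  assumes "k = 2 ^ p" "m = 2 ^ (n - p)" "card (verts G) = 2 ^ n" "p \<le> n"
  shows "balanced_cut (2 ^ (j - p)) (2 ^ j - 1) = level_cost n p j"
proof -
  have n: "(2::int) ^ n = 2 ^ (n - p) * 2 ^ p" using assms(4) by (simp flip: power_add)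
  have bal: "balanced_cut q a = a * (2 ^ n - 2 ^ (n - p) - a) + ((2 * q - 1) * a - 2 ^ p * (q * (q - 1)))"
    for q a
    unfolding balanced_cut_def unfolding assms(1-3) by simp
  show ?thesis
  proof (cases "j \<le> p")
    case True
    have "(z - 1) * (x * y - x - (z - 1)) + ((2 * 1 - 1) * (z - 1) - y * (1 * (1 - 1)))
        = (z - 1) * (x * (y - 1) - (z - 2))" for x y z :: int
      by algebra
    moreover have "j - p = 0" using True by simp
    ultimately show ?thesis using True by (simp only: bal n level_cost_def if_True power_0)
  next
    case False
    then have j: "(2::int) ^ j = 2 ^ (j - p) * 2 ^ p" by (simp flip: power_add)
    have "(q * y - 1) * (x * y - x - (q * y - 1)) + ((2 * q - 1) * (q * y - 1) - y * (q * (q - 1)))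
        = (y - 1) * (x * (q * y - 1) - q * (q * y - 2))" for q x y :: int
      by algebra
    then show ?thesis using False by (simp only: bal n j level_cost_def if_False)
  qed
qed

text \<open>A subtree of height \<open>j\<close> has between \<open>q - 1\<close> and \<open>q\<close> periods of length \<open>2 ^ p\<close>, for
  \<open>q = 2 ^ (j - p)\<close>. If \<open>j \<le> p\<close>, then \<open>q = 1\<close> and the labels of the subtree fit into one period.\<close>

lemma level_size_bounds:
  fixes j p :: nat
  shows "(2 ^ (j - p) - 1) * 2 ^ p \<le> (2 ^ j - 1 :: nat)" "2 ^ j - 1 \<le> 2 ^ (j - p) * (2 ^ p :: nat)"
proof -
  have "(2 ^ (j - p) - 1) * 2 ^ p \<le> (2 ^ j - 1 :: nat) \<and> 2 ^ j - 1 \<le> 2 ^ (j - p) * (2 ^ p :: nat)"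
  proof (cases "j \<le> p")
    case True
    then have "(2::nat) ^ j \<le> 2 ^ p" by (simp add: power_increasing)
    then have "2 ^ j - 1 \<le> (2::nat) ^ p" by linarith
    then show ?thesis using True by simp
  next
    case False
    then have "(2::nat) ^ j = 2 ^ (j - p) * 2 ^ p" by (simp flip: power_add)
    moreover have "(1::nat) \<le> 2 ^ p" by simp
    moreover have "(q - 1) * y \<le> q * y - 1 \<and> q * y - 1 \<le> q * y" if "1 \<le> y" for q y :: nat
      using that by (simp add: diff_mult_distrib diff_le_mono2)
    ultimately show ?thesis by metis
  qed
  then show "(2 ^ (j - p) - 1) * 2 ^ p \<le> (2 ^ j - 1 :: nat)"
    "2 ^ j - 1 \<le> 2 ^ (j - p) * (2 ^ p :: nat)" by auto
qed

section \<open>The minimum wirelength\<close>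

theorem mainTheorem1:
  fixes p n :: nat
    and G :: "'a graph" and labG :: "'a \<Rightarrow> nat"
    and t :: "'b tree" and \<rho> :: 'b and H :: "'b graph" and labH :: "'b \<Rightarrow> nat"
    and f :: "'a \<Rightarrow> 'b" and P :: "'a set \<Rightarrow> 'b list"
  assumes "2 \<le> p" and "2 \<le> n" and "p \<le> n"
    and "bij_betw labG (verts G) {1..2 ^ n}"
    and "balanced_complete_multipartite (2 ^ p) (2 ^ (n - p)) G
           {{x \<in> verts G. labG x mod 2 ^ p = c} | c. c < 2 ^ p}"
    and "complete_binary_tree n t" and "\<rho> \<notin> set_tree t" and "H = one_rooted_graph t \<rho>"
    and "inorder_labeling n t \<rho> labH"
    and "\<forall>x\<in>verts G. f x \<in> verts H \<and> labH (f x) = labG x"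
    and "\<forall>x y. {x, y} \<in> edges G \<longrightarrow> shortest_path_between H (f x) (f y) (P {x, y})"
  shows "graph_embedding G H f P \<and>
    (\<forall>g Q. graph_embedding G H g Q \<longrightarrow> embedding_wirelength G P \<le> embedding_wirelength G Q) \<and>
    int (WL G H) = (\<Sum>j = 1..n. \<Sum>i = 1..(2::nat) ^ (n - j). level_cost n p j)"
proof -
  let ?c = "\<lambda>x. labG x mod 2 ^ p"
  define T where "T = \<langle>t, \<rho>, \<langle>\<rangle>\<rangle>"
  have H: "H = tree_graph T"
    using assms(8) by (simp add: one_rooted_graph_def tree_graph_def T_def)
  have t: "complete t" "height t = n" "distinct (inorder t)"
    using assms(6) by (auto simp: complete_binary_tree_def)
  have lab: "map labH (inorder t) = [1..<2 ^ n]" "labH \<rho> = 2 ^ n"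
    using assms(9) by (auto simp: inorder_labeling_def)
  have distT: "distinct (inorder T)" using t(3) assms(7) by (simp add: T_def)
  have "map labH (inorder T) = [1..<Suc (2 ^ n)]" by (simp add: T_def lab)
  then have injH: "inj_on labH (set_tree T)"
    by (metis distinct_map distinct_upt set_inorder)
  have cardT: "card (set_tree T) = 2 ^ n"
    using card_complete_tree [OF t(1,3)] t(2) assms(7) by (simp add: T_def)
  have cardG: "card (verts G) = 2 ^ n"
    using bij_betw_same_card [OF assms(4)] by simp
  have simpleG: "simple_graph G"
    using assms(5) by (simp add: balanced_complete_multipartite_def)
  interpret colour_classes G ?c "2 ^ p" "2 ^ (n - p)"
    using assms(5) by (rule balanced_multipartite_colour_classes) simp
  have subT: "set_tree s \<subseteq> set_tree T" if "s \<in> set (nonempty_subtrees t)" for s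
    using subtree_subset [OF that] by (auto simp: T_def)
  have card_s: "card (set_tree s) = 2 ^ height s - 1" if "s \<in> set (nonempty_subtrees t)" for s
    using card_complete_tree complete_subtree distinct_subtree that t(1,3) by metis
  let ?opt = "\<Sum>s\<leftarrow>nonempty_subtrees t. level_cost n p (height s)"
  have cost: "balanced_cut (2 ^ (height s - p)) (int (card (set_tree s))) = level_cost n p (height s)"
    if "s \<in> set (nonempty_subtrees t)" for s
    using balanced_cut_eq_level_cost [OF refl refl cardG assms(3)] card_s [OF that]
    by (simp add: of_nat_diff)

  have lower: "?opt \<le> int (embedding_wirelength G Q)" if g: "graph_embedding G H g Q" for g Q
  proof -
    \<comment> \<open>Guest and host both have \<open>2 ^ n\<close> vertices, so every embedding is a bijection.\<close>
    have "g ` verts G = set_tree T"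
      using g cardG cardT
      by (intro card_subset_eq) (auto simp: graph_embedding_def H tree_graph_def card_image)
    then have bij: "bij_betw g (verts G) (set_tree T)"
      using g by (simp add: bij_betw_def graph_embedding_def)
    have "?opt \<le> (\<Sum>s\<leftarrow>nonempty_subtrees t. int (card (edge_cut G (pullback G g (set_tree s)))))"
    proof (rule sum_list_mono)
      fix s assume s: "s \<in> set (nonempty_subtrees t)"
      have "pullback G g (set_tree s) \<subseteq> verts G" by (auto simp: pullback_def)
      from balanced_cut_le [OF this, of "2 ^ (height s - p)"]
      show "level_cost n p (height s) \<le> int (card (edge_cut G (pullback G g (set_tree s))))"
        by (simp only: card_pullback [OF bij subT [OF s]] cost [OF s])
    qed
    also have "\<dots> \<le> int (\<Sum>s\<leftarrow>nonempty_subtrees T. card (edge_cut G (pullback G g (set_tree s))))"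
      by (simp add: T_def int_sum_list)
    also have "\<dots> \<le> int (embedding_wirelength G Q)"
      using embedding_wirelength_ge_sum_edge_cut [OF simpleG distT g [unfolded H]] by linarith
    finally show ?thesis .
  qed

  have f: "f x \<in> set_tree T \<and> labH (f x) = labG x" if "x \<in> verts G" for x
    using assms(10) that by (simp add: H tree_graph_def)
  have inj_f: "inj_on f (verts G)"
    using assms(4) f unfolding bij_betw_def inj_on_def by metis
  have f_image: "f ` verts G = set_tree T"
    using f cardG cardT by (intro card_subset_eq) (auto simp: card_image [OF inj_f])
  have bij_f: "bij_betw f (verts G) (set_tree T)"
    using inj_f f_image by (simp add: bij_betw_def)
  have emb: "graph_embedding G H f P"
    using inj_f f_image assms(11)
    by (simp add: graph_embedding_def shortest_path_between_def H tree_graph_def)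
  have "int (card (edge_cut G (pullback G f (set_tree s)))) = level_cost n p (height s)"
    if s: "s \<in> set (nonempty_subtrees t)" for s
  proof -
    have "int (card {x \<in> pullback G f (set_tree s). ?c x = i})
        \<in> {int (2 ^ (height s - p)) - 1, int (2 ^ (height s - p))}" if "i < 2 ^ p" for i
    proof (rule subtree_pullback_residues [OF lab(1) s assms(4) _ f _ injH that])
      show "set_tree t \<subseteq> set_tree T" by (auto simp: T_def)
    qed (use level_size_bounds card_s [OF s] in auto)
    then have "int (card (edge_cut G (pullback G f (set_tree s)))) =
        balanced_cut (2 ^ (height s - p)) (int (card (pullback G f (set_tree s))))"
      by (intro balanced_cut_eq) (auto simp: pullback_def)
    then show ?thesis by (simp only: card_pullback [OF bij_f subT [OF s]] cost [OF s])
  qed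
  then have "?opt = (\<Sum>s\<leftarrow>nonempty_subtrees t. int (card (edge_cut G (pullback G f (set_tree s)))))"
    by (intro arg_cong [of _ _ sum_list] map_cong) simp_all
  also have "\<dots> = int (\<Sum>s\<leftarrow>nonempty_subtrees T. card (edge_cut G (pullback G f (set_tree s))))"
  proof -
    \<comment> \<open>\<open>T\<close> itself is the one subtree of \<open>T\<close> with no edge above it, and it separates no vertices.\<close>
    have "edge_cut G (pullback G f (set_tree T)) = {}"
      using simpleG f by (auto simp: edge_cut_def pullback_def simple_graph_def)
    then show ?thesis by (simp add: T_def int_sum_list)
  qed
  also have "\<dots> = int (embedding_wirelength G P)"
    using embedding_wirelength_eq_sum_edge_cut [OF simpleG distT, of f P] f_image assms(11)
    by (simp add: H)
  finally have wl: "int (embedding_wirelength G P) = ?opt" ..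
  have optimal: "embedding_wirelength G P \<le> embedding_wirelength G Q"
    if "graph_embedding G H g Q" for g Q
    using lower [OF that] wl by linarith
  have "WL G H = embedding_wirelength G P"
    unfolding WL_def by (rule Least_equality) (use emb optimal in auto)
  moreover have "?opt = (\<Sum>j = 1..n. \<Sum>i = 1..(2::nat) ^ (n - j). level_cost n p j)"
    using sum_subtrees_complete [OF t(1), of "level_cost n p"] t(2) by simp
  ultimately show ?thesis using emb optimal wl by auto
qed

end
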